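(* Let $S,O$ be sets with scale maps $\iota_S:S\to\mathbb{R}_{>0}$, $\iota_O:O\to\mathbb{R}_{>0}$, let $J(x)=\tfrac12(x+x^{-1})-1$ for $x>0$, and let $\mathcal{R}$ be the admissible reference structure with cost $c_{\mathcal{R}}(s,o)=J(\iota_S(s)/\iota_O(o))$. Suppose $Y:=\iota_O(O)\subset\mathbb{R}_{>0}$ is nonempty and closed in the usual topology on $(0,\infty)$. Then for every $s\in S$ the meaning set $\mathrm{Mean}_{\mathcal{R}}(s)$ is nonempty. Moreover, if $x:=\iota_S(s)\in Y$, then every $o\in O$ with $\iota_O(o)=x$ belongs to $\mathrm{Mean}_{\mathcal{R}}(s)$ and satisfies $c_{\mathcal{R}}(s,o)=0$.
   Context: For a reference cost $c_{\mathcal{R}}:S\times O\to\mathbb{R}_{\ge0}$ and $s\in S$, the meaning set is $\mathrm{Mean}_{\mathcal{R}}(s):=\{o\in O:\ c_{\mathcal{R}}(s,o)\le c_{\mathcal{R}}(s,o')\ \text{for all } o'\in O\}$. "Closed in $(0,\infty)$" means closed in the subspace topology of $(0,\infty)\subset\mathbb{R}$. *)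

theory Defs
  imports "HOL-Analysis.Analysis"
begin

(* Only the values at x > 0 are meaningful. *)
definition J :: "real \<Rightarrow> real" where
  "J x = (x + inverse x) / 2 - 1"

definition ratio_cost :: "('s \<Rightarrow> real) \<Rightarrow> ('o \<Rightarrow> real) \<Rightarrow> 's \<Rightarrow> 'o \<Rightarrow> real" where
  "ratio_cost \<iota>S \<iota>O s obj = J (\<iota>S s / \<iota>O obj)"

definition Mean :: "'o set \<Rightarrow> ('s \<Rightarrow> 'o \<Rightarrow> real) \<Rightarrow> 's \<Rightarrow> 'o set" where
  "Mean Ob c s = {obj \<in> Ob. \<forall>obj'\<in>Ob. c s obj \<le> c s obj'}"

lemma J_nonneg:
  assumes "x > 0"
  shows "J x \<ge> 0"
proof -
  have "J x = (x - 1)\<^sup>2 / (2 * x)"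
    using assms by (simp add: J_def field_simps power2_eq_square)
  then show ?thesis using assms by simp
qed

(* The cost induced by positive scale maps takes values in the nonnegative reals on S x Ob,
   as required of a reference cost. *)
lemma ratio_cost_nonneg:
  assumes "\<iota>S \<in> S \<rightarrow> {0<..}" and "\<iota>O \<in> Ob \<rightarrow> {0<..}" and "s \<in> S" and "obj \<in> Ob"
  shows "ratio_cost \<iota>S \<iota>O s obj \<ge> 0"
proof -
  have "\<iota>S s > 0" "\<iota>O obj > 0"
    using assms by (auto simp: Pi_iff)
  then show ?thesis by (simp add: ratio_cost_def J_nonneg)
qed

end

(* A sublevel set of the map taking y to J (x / y) on the positive reals lies in a compact interval
   bounded away from 0, so relative closedness of Y in the positive reals suffices for the
   extreme value theorem. *)

theory Submission
  imports Defs
begin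

text \<open>On the positive reals \<open>J x\<close> equals
  \<open>(x - 1)\<^sup>2 / (2 * x)\<close>, a square over a positive number.\<close>

lemma J_eq_0_iff:
  assumes "x > 0"
  shows "J x = 0 \<longleftrightarrow> x = 1"
proof -
  have "J x = (x - 1)\<^sup>2 / (2 * x)"
    using assms by (simp add: J_def field_simps power2_eq_square)
  then show ?thesis using assms by simp
qed

text \<open>Twice \<open>J (x / y) + 1\<close> is \<open>x / y + y / x\<close>. Both summands are
  positive, so each alone is at most \<open>2 * (c + 1)\<close>; one bounds \<open>y\<close> from
  below, the other from above.\<close>

lemma J_ratio_le_bounds:
  assumes "x > 0" "y > 0" "J (x / y) \<le> c"
  shows "x / (2 * (c + 1)) \<le> y" "y \<le> 2 * (c + 1) * x"
proof -
  have c: "x / y + y / x \<le> 2 * (c + 1)"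
    using assms(3) by (simp add: J_def field_simps)
  have pos: "x / y > 0" "y / x > 0"
    using assms by simp_all
  then have "2 * (c + 1) > 0" and "x / y \<le> 2 * (c + 1)" and "y / x \<le> 2 * (c + 1)"
    using c by linarith+
  then show "x / (2 * (c + 1)) \<le> y" "y \<le> 2 * (c + 1) * x"
    using assms by (simp_all only: pos_divide_le_eq mult.commute)
qed

lemma J_ratio_attains_inf:
  assumes "x > 0" "Y \<noteq> {}" and cl: "closedin (top_of_set {0<..}) Y"
  obtains y where "y \<in> Y" "\<And>z. z \<in> Y \<Longrightarrow> J (x / y) \<le> J (x / z)"
proof -
  obtain T where "closed T" and Y: "Y = {0<..} \<inter> T"
    using cl by (auto simp: closedin_closed)
  obtain y0 where y0: "y0 \<in> Y"
    using assms(2) by blast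
  \<comment> \<open>\<open>M\<close> is the factor from \<open>J_ratio_le_bounds\<close> at the
    level of an arbitrary point \<open>y0\<close> of \<open>Y\<close>.\<close>
  define M where "M = 2 * (J (x / y0) + 1)"
  have "M > 0"
    using J_nonneg[of "x / y0"] y0 assms(1) by (simp add: M_def Y)
  \<comment> \<open>Intersecting with \<open>T\<close>, closed in all of the reals, makes
    \<open>K\<close> compact; the interval stays inside the positive reals, so \<open>K\<close> is
    still part of \<open>Y\<close>.\<close>
  define K where "K = {x / M..M * x} \<inter> T"
  have pos: "{x / M..M * x} \<subseteq> {0<..}"
  proof
    fix z assume "z \<in> {x / M..M * x}"
    moreover have "x / M > 0"
      using assms(1) \<open>M > 0\<close> by simp
    ultimately show "z \<in> {0<..}"
      by (simp add: less_le_trans)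
  qed
  then have sub: "K \<subseteq> Y"
    by (auto simp: K_def Y)
  have in_K: "z \<in> K" if "z \<in> Y" "J (x / z) \<le> J (x / y0)" for z
    using J_ratio_le_bounds[of x z "J (x / y0)"] that assms(1) by (simp add: K_def Y M_def)
  have "compact K"
    unfolding K_def using \<open>closed T\<close> by (intro compact_Int_closed compact_Icc)
  moreover have "y0 \<in> K"
    using in_K[OF y0] by simp
  \<comment> \<open>Positivity on \<open>K\<close> keeps both \<open>y\<close> and the inverted
    ratio \<open>x / y\<close> away from 0.\<close>
  moreover have "continuous_on K (\<lambda>y. J (x / y))"
    unfolding J_def using pos assms(1) by (intro continuous_intros) (auto simp: K_def)
  ultimately obtain y where y: "y \<in> K" "\<forall>z\<in>K. J (x / y) \<le> J (x / z)"
    using continuous_attains_inf[of K "\<lambda>y. J (x / y)"] by blast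
  show thesis
  proof (rule that)
    show "y \<in> Y"
      using y(1) sub by blast
    \<comment> \<open>A point \<open>z\<close> of \<open>Y\<close> outside \<open>K\<close> has cost
      above that of \<open>y0\<close>, which is in turn at least the minimum over
      \<open>K\<close>.\<close>
    show "J (x / y) \<le> J (x / z)" if "z \<in> Y" for z
      using y(2) \<open>y0 \<in> K\<close> in_K[OF that] by force
  qed
qed

theorem theorem4p5:
  fixes S :: "'s set" and Ob :: "'o set"
    and \<iota>S :: "'s \<Rightarrow> real" and \<iota>O :: "'o \<Rightarrow> real"
    and Y :: "real set"
  assumes "\<iota>S \<in> S \<rightarrow> {0<..}" and "\<iota>O \<in> Ob \<rightarrow> {0<..}"
    and "Y = \<iota>O ` Ob"
    and "Y \<noteq> {}"
    and "closedin (top_of_set {0<..}) Y"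
  shows "(\<forall>s\<in>S. Mean Ob (ratio_cost \<iota>S \<iota>O) s \<noteq> {}) \<and>
    (\<forall>s\<in>S. \<iota>S s \<in> Y \<longrightarrow>
       (\<forall>obj\<in>Ob. \<iota>O obj = \<iota>S s \<longrightarrow>
          obj \<in> Mean Ob (ratio_cost \<iota>S \<iota>O) s \<and> ratio_cost \<iota>S \<iota>O s obj = 0))"
proof (intro conjI ballI impI)
  fix s assume s: "s \<in> S"
  then have "\<iota>S s > 0"
    using assms(1) by auto
  then obtain y where "y \<in> Y" and y: "\<And>z. z \<in> Y \<Longrightarrow> J (\<iota>S s / y) \<le> J (\<iota>S s / z)"
    using J_ratio_attains_inf assms(4,5) by blast
  \<comment> \<open>Any preimage of the optimal scale \<open>y\<close> has minimal cost, since the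
    cost depends on an object only through its scale.\<close>
  then obtain obj where "obj \<in> Ob" "y = \<iota>O obj"
    using assms(3) by blast
  then have "obj \<in> Mean Ob (ratio_cost \<iota>S \<iota>O) s"
    using y assms(3) by (auto simp: Mean_def ratio_cost_def)
  then show "Mean Ob (ratio_cost \<iota>S \<iota>O) s \<noteq> {}"
    by blast
next
  fix s obj assume s: "s \<in> S" and obj: "obj \<in> Ob" "\<iota>O obj = \<iota>S s"
  have "\<iota>S s > 0"
    using s assms(1) by auto
  then show zero: "ratio_cost \<iota>S \<iota>O s obj = 0"
    using obj by (simp add: ratio_cost_def J_eq_0_iff)
  \<comment> \<open>Costs are nonnegative, so an object of cost 0 is a minimizer.\<close>
  show "obj \<in> Mean Ob (ratio_cost \<iota>S \<iota>O) s"
    using obj(1) ratio_cost_nonneg[OF assms(1,2) s] by (simp add: Mean_def zero)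
qed

end
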